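(* Let $$c_1=\inf\Bigl\{C:\ \frac{\sqrt n\,\sigma^3\,\|F_n-\Phi\|_1}{E|X|^3}\le C\ \text{ for all } G\in\mathcal{F}_1 \text{ and all } n\ge 1\Bigr\},$$ where, for $G\in\mathcal{F}_1$, $X$ has distribution $G$, $\sigma^2=1$ is the variance of $X$, and $F_n$ is the distribution function of $(X_1+\cdots+X_n)/(\sigma\sqrt n)$ with $X_1,\ldots,X_n$ independent with common distribution $G$. Then $$c_1\ \ge\ \frac{2\sqrt{\pi}\,(2\Phi(1)-1)-(\sqrt{\pi}+\sqrt{2})+2e^{-1/2}\sqrt{2}}{\sqrt{\pi}}\;(=0.535377\ldots).$$
   Context: $\mathcal{F}_1$ is the collection of probability distributions on $\mathbb{R}$ with mean zero, variance $1$ and finite absolute third moment. $\Phi$ is the standard normal distribution function. For distribution functions $F,G$ on $\mathbb{R}$, $\|F-G\|_1=\int_{-\infty}^\infty|F(x)-G(x)|\,dx$. *)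

theory Defs
  imports "HOL-Probability.Probability"
begin

definition \<Phi> :: "real \<Rightarrow> real" where
  "\<Phi> = cdf std_normal_distribution"

text \<open>Finiteness of the third absolute moment makes the integrals in the mean and the
  variance converge, so these two conditions are not met through a default value of the
  Bochner integral.\<close>

definition \<F>\<^sub>1 :: "real measure set" where
  "\<F>\<^sub>1 = {G. real_distribution G \<and> integrable G (\<lambda>x. \<bar>x\<bar> ^ 3)
             \<and> prob_space.expectation G (\<lambda>x. x) = 0
             \<and> prob_space.variance G (\<lambda>x. x) = 1}"

definition std_dev :: "real measure \<Rightarrow> real" where
  "std_dev G = sqrt (prob_space.variance G (\<lambda>x. x))"

definition abs_third_moment :: "real measure \<Rightarrow> real" where
  "abs_third_moment G = prob_space.expectation G (\<lambda>x. \<bar>x\<bar> ^ 3)"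

text \<open>The independent variables are the coordinate projections on the n-fold product of \<open>G\<close>;
  \<open>normalized_sum_cdf_eq\<close> below shows that any other realization gives the same function.\<close>

definition normalized_sum_cdf :: "real measure \<Rightarrow> nat \<Rightarrow> real \<Rightarrow> real" where
  "normalized_sum_cdf G n =
     cdf (distr (\<Pi>\<^sub>M i\<in>{1..n}. G) borel (\<lambda>x. (\<Sum>i=1..n. x i) / (std_dev G * sqrt (real n))))"

definition L1_dist :: "(real \<Rightarrow> real) \<Rightarrow> (real \<Rightarrow> real) \<Rightarrow> ennreal" where
  "L1_dist F H = (\<integral>\<^sup>+x. ennreal \<bar>F x - H x\<bar> \<partial>lborel)"

text \<open>The infimum of a set of real numbers, taken in the extended reals so that the
  infimum of the empty set is \<open>\<infinity>\<close>.\<close>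

definition c\<^sub>1 :: ereal where
  "c\<^sub>1 = Inf {ereal C | C::real. \<forall>G\<in>\<F>\<^sub>1. \<forall>n\<ge>1.
          ereal (sqrt (real n) * std_dev G ^ 3) * enn2ereal (L1_dist (normalized_sum_cdf G n) \<Phi>)
            / ereal (abs_third_moment G) \<le> ereal C}"

lemma (in prob_space) normalized_sum_cdf_eq:
  fixes X :: "nat \<Rightarrow> 'a \<Rightarrow> real"
  assumes n: "n \<ge> 1"
    and G: "real_distribution G"
    and indep: "indep_vars (\<lambda>_. borel) X {1..n}"
    and dist: "\<And>i. i \<in> {1..n} \<Longrightarrow> distr M borel (X i) = G"
  shows "normalized_sum_cdf G n =
    cdf (distr M borel (\<lambda>\<omega>. (\<Sum>i=1..n. X i \<omega>) / (std_dev G * sqrt (real n))))"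
proof -
  interpret G: real_distribution G by (rule G)
  have rv: "\<And>i. i \<in> {1..n} \<Longrightarrow> random_variable borel (X i)"
    using indep by (auto simp: indep_vars_def)
  have meas: "(\<lambda>\<omega>. \<lambda>i\<in>{1..n}. X i \<omega>) \<in> measurable M (\<Pi>\<^sub>M i\<in>{1..n}. borel)"
    using rv by (intro measurable_restrict) auto
  have "(\<Pi>\<^sub>M i\<in>{1..n}. G) = (\<Pi>\<^sub>M i\<in>{1..n}. distr M borel (X i))"
    by (intro PiM_cong) (simp_all add: dist)
  also have "\<dots> = distr M (\<Pi>\<^sub>M i\<in>{1..n}. borel) (\<lambda>\<omega>. \<lambda>i\<in>{1..n}. X i \<omega>)"
    using indep_vars_iff_distr_eq_PiM'[of "{1..n}" X "\<lambda>_. borel"] n rv indep by auto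
  finally have eq: "(\<Pi>\<^sub>M i\<in>{1..n}. G) =
      distr M (\<Pi>\<^sub>M i\<in>{1..n}. borel) (\<lambda>\<omega>. \<lambda>i\<in>{1..n}. X i \<omega>)" .
  have fm: "(\<lambda>x. (\<Sum>i=1..n. x i) / (std_dev G * sqrt (real n)))
      \<in> measurable (\<Pi>\<^sub>M i\<in>{1..n}. borel) (borel :: real measure)"
    by (intro borel_measurable_divide borel_measurable_sum borel_measurable_const
          measurable_component_singleton) auto
  show ?thesis
    unfolding normalized_sum_cdf_def eq
    by (subst distr_distr[OF fm meas]) (simp add: o_def)
qed

end

theory Submission
  imports Defs "HOL-Real_Asymp.Real_Asymp"
begin

text \<open>Already a single fair sign (\<open>n = 1\<close>, third absolute moment \<open>1\<close>) attains the claimed value.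
  Its distribution function steps from \<open>0\<close> to \<open>1/2\<close> to \<open>1\<close> at \<open>- 1\<close> and \<open>1\<close>, so by symmetry
  the distance to \<open>\<Phi>\<close> is twice the sum of the integral of \<open>\<Phi> - 1/2\<close> over \<open>[0, 1]\<close> and that of
  \<open>1 - \<Phi>\<close> over \<open>[1, \<infinity>)\<close>; both are explicit since \<open>x \<Phi>(x) + \<phi>(x)\<close> is an antiderivative of
  \<open>\<Phi>\<close>, where \<open>\<phi>\<close> is the standard normal density.
  The decimals come from the alternating Taylor sums of \<open>exp (- y)\<close>, integrated term by term.\<close>

section \<open>The normal distribution function: derivative, symmetry and tail\<close>

lemma continuous_on_std_normal_density: "continuous_on A std_normal_density"
  unfolding std_normal_density_def by (intro continuous_intros) auto

lemma \<Phi>_diff_eq_integral: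
  assumes "a \<le> b"
  shows "\<Phi> b - \<Phi> a = integral {a..b} std_normal_density"
proof (cases "a = b")
  case False
  interpret real_distribution std_normal_distribution by (rule real_dist_normal_dist)
  have si: "set_integrable lborel {a..b} std_normal_density"
    by (intro borel_integrable_atLeastAtMost' continuous_on_std_normal_density)
  have "\<Phi> b - \<Phi> a = measure std_normal_distribution {a<..b}"
    unfolding \<Phi>_def using False assms by (intro cdf_diff_eq) auto
  also have "\<dots> = (\<integral>x. indicator {a<..b} x \<partial>std_normal_distribution)"
    by simp
  also have "\<dots> = (\<integral>x. std_normal_density x * indicator {a<..b} x \<partial>lborel)"
    by (subst integral_density) auto
  also have "\<dots> = (\<integral>x. indicator {a..b} x *\<^sub>R std_normal_density x \<partial>lborel)"
    using AE_lborel_singleton[of a]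
    by (intro integral_cong_AE) (auto split: split_indicator)
  also have "\<dots> = integral {a..b} std_normal_density"
    using set_borel_integral_eq_integral(2)[OF si] by (simp add: set_lebesgue_integral_def)
  finally show ?thesis .
qed simp

text \<open>Near \<open>x\<close>, \<Phi> is a constant plus the integral of the density from
  \<open>x - 1\<close>; this base point keeps \<open>x\<close> in the interior, so the fundamental
  theorem of calculus gives a two-sided derivative.\<close>

lemma DERIV_\<Phi>: "(\<Phi> has_real_derivative std_normal_density x) (at x)"
proof -
  have "((\<lambda>u. integral {x - 1..u} std_normal_density) has_real_derivative std_normal_density x)
      (at x within {x - 1..x + 1})"
    by (rule integral_has_real_derivative) (auto intro: continuous_on_std_normal_density)
  then have "((\<lambda>u. integral {x - 1..u} std_normal_density) has_real_derivative std_normal_density x) (at x)"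
    by (simp add: at_within_Icc_at)
  then have "((\<lambda>u. \<Phi> (x - 1) + integral {x - 1..u} std_normal_density)
      has_real_derivative std_normal_density x) (at x)"
    by (auto intro!: derivative_eq_intros)
  then show ?thesis
  proof (rule has_field_derivative_transform_within_open[of _ _ _ "{x - 1<..<x + 1}"])
    show "\<Phi> (x - 1) + integral {x - 1..u} std_normal_density = \<Phi> u" if "u \<in> {x - 1<..<x + 1}" for u
      using \<Phi>_diff_eq_integral[of "x - 1" u] that by simp
  qed auto
qed

lemma DERIV_std_normal_density:
  "(std_normal_density has_real_derivative - (x * std_normal_density x)) (at x)"
  unfolding std_normal_density_def
  by (auto intro!: derivative_eq_intros simp: field_simps power2_eq_square)

text \<open>The density is even, so \<Phi>(x) + \<Phi>(-x) has derivative zero and is constant; its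
  limit at infinity identifies the constant as 1.\<close>

lemma \<Phi>_uminus: "\<Phi> (- x) = 1 - \<Phi> x"
proof -
  interpret real_distribution std_normal_distribution by (rule real_dist_normal_dist)
  have "((\<lambda>x. \<Phi> x + \<Phi> (- x)) has_real_derivative 0) (at y)" for y
    using DERIV_add[OF DERIV_\<Phi>[of y] DERIV_mirror[THEN iffD1, OF DERIV_\<Phi>[of "- y"]]]
    by (simp add: std_normal_density_def)
  then have const: "(\<lambda>y. \<Phi> y + \<Phi> (- y)) = (\<lambda>_. \<Phi> x + \<Phi> (- x))"
    by (intro ext DERIV_isconst_all) auto
  have "((\<lambda>y. \<Phi> y + \<Phi> (- y)) \<longlongrightarrow> 1 + 0) at_top"
    unfolding \<Phi>_def
    by (intro tendsto_add cdf_lim_at_top_prob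
        filterlim_compose[OF cdf_lim_at_bot filterlim_uminus_at_bot_at_top])
  then have "\<Phi> x + \<Phi> (- x) = 1"
    unfolding const by (simp add: tendsto_const_iff)
  then show ?thesis by simp
qed

lemma \<Phi>_0: "\<Phi> 0 = 1 / 2"
  using \<Phi>_uminus[of 0] by simp

lemma \<Phi>_mono: "x \<le> y \<Longrightarrow> \<Phi> x \<le> \<Phi> y"
  by (rule DERIV_nonneg_imp_nondecreasing[of x y \<Phi>]) (auto intro: DERIV_\<Phi> exI)

lemma \<Phi>_le_1: "\<Phi> x \<le> 1"
proof -
  interpret real_distribution std_normal_distribution by (rule real_dist_normal_dist)
  show ?thesis unfolding \<Phi>_def by (rule cdf_bounded_prob)
qed

lemma borel_measurable_\<Phi> [measurable]: "\<Phi> \<in> borel_measurable borel"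
  by (intro borel_measurable_continuous_onI DERIV_continuous_on)
    (auto intro: DERIV_\<Phi>)

text \<open>Chebyshev's inequality bounds the tail by \<open>1 / x\<^sup>2\<close>. This crude bound
  suffices to make the boundary term \<open>x * (1 - \<Phi> x)\<close> vanish at infinity.\<close>

lemma \<Phi>_tail_le:
  assumes "x > 0"
  shows "x * (1 - \<Phi> x) \<le> 1 / x"
proof -
  interpret real_distribution std_normal_distribution by (rule real_dist_normal_dist)
  have E: "expectation (\<lambda>x. x) = 0" "expectation (\<lambda>x. x\<^sup>2) = 1"
    using integral_std_normal_distribution_moment_odd[of 1] std_normal_distribution_even_moments(1)[of 1] by auto
  have "1 - \<Phi> x = \<Phi> (- x)" by (simp add: \<Phi>_uminus)
  also have "\<dots> \<le> prob {y \<in> space std_normal_distribution. \<bar>y - expectation (\<lambda>x. x)\<bar> \<ge> x}"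
    unfolding \<Phi>_def cdf_def using assms by (intro finite_measure_mono) (auto simp: E)
  also have "\<dots> \<le> 1 / x\<^sup>2"
    using Chebyshev_inequality[of "\<lambda>x. x" x] assms integrable_std_normal_distribution_moment[of 2]
    by (simp add: E)
  finally show ?thesis using assms by (simp add: field_simps power2_eq_square)
qed

lemma std_normal_density_at_top: "(std_normal_density \<longlongrightarrow> 0) at_top"
  unfolding std_normal_density_def by real_asymp

section \<open>The two explicit integrals\<close>

lemma nn_integral_\<Phi>_minus_half_0_1:
  "(\<integral>\<^sup>+x. ennreal (\<Phi> x - 1 / 2) * indicator {0..1} x \<partial>lborel) =
     ennreal (\<Phi> 1 + std_normal_density 1 - std_normal_density 0 - 1 / 2)"
proof -
  let ?F = "\<lambda>x. x * \<Phi> x + std_normal_density x - x / 2"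
  have "(\<integral>\<^sup>+x. ennreal (\<Phi> x - 1 / 2) * indicator {0..1} x \<partial>lborel) = ennreal (?F 1 - ?F 0)"
  proof (rule nn_integral_FTC_Icc)
    show "(?F has_real_derivative \<Phi> x - 1 / 2) (at x)" for x
      by (auto intro!: derivative_eq_intros DERIV_\<Phi> DERIV_std_normal_density)
    show "0 \<le> \<Phi> x - 1 / 2" if "x \<in> {0..1}" for x
      using \<Phi>_mono[of 0 x] that by (simp add: \<Phi>_0)
  qed auto
  then show ?thesis by (simp add: algebra_simps)
qed

lemma nn_integral_\<Phi>_upper_tail_1:
  "(\<integral>\<^sup>+x. ennreal (1 - \<Phi> x) * indicator {1..} x \<partial>lborel) =
     ennreal (\<Phi> 1 + std_normal_density 1 - 1)"
proof -
  \<comment> \<open>The terms in \<open>x\<close> times the density cancel in the derivative, which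
    leaves \<open>1 - \<Phi> x\<close>. Since \<open>?F\<close> tends to 0, the integral over the
    half-line is \<open>- ?F 1\<close>.\<close>
  let ?F = "\<lambda>x. x * (1 - \<Phi> x) - std_normal_density x"
  have "((\<lambda>x. x * (1 - \<Phi> x)) \<longlongrightarrow> 0) at_top"
  proof (rule tendsto_sandwich)
    show "eventually (\<lambda>x. 0 \<le> x * (1 - \<Phi> x)) at_top"
      using eventually_ge_at_top[of 0] by eventually_elim (simp add: \<Phi>_le_1)
    show "eventually (\<lambda>x. x * (1 - \<Phi> x) \<le> 1 / x) at_top"
      using eventually_gt_at_top[of 0] by eventually_elim (rule \<Phi>_tail_le)
    show "((\<lambda>x. 1 / x :: real) \<longlongrightarrow> 0) at_top" by real_asymp
  qed simp
  then have lim: "(?F \<longlongrightarrow> 0) at_top"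
    using tendsto_diff[OF _ std_normal_density_at_top] by fastforce
  have "(\<integral>\<^sup>+x. ennreal (1 - \<Phi> x) * indicator {1..} x \<partial>lborel) = ennreal (0 - ?F 1)"
  proof (rule nn_integral_FTC_atLeast[OF _ _ _ lim])
    show "(?F has_real_derivative 1 - \<Phi> x) (at x)" for x
      by (auto intro!: derivative_eq_intros DERIV_\<Phi> DERIV_std_normal_density)
  qed (auto simp: \<Phi>_le_1)
  then show ?thesis by (simp add: algebra_simps)
qed

section \<open>The fair sign\<close>

definition rademacher :: "real measure" where
  "rademacher = distr (measure_pmf (bernoulli_pmf (1 / 2))) borel (\<lambda>b. if b then 1 else - 1)"

lemma real_distribution_rademacher: "real_distribution rademacher"
  unfolding rademacher_def by (rule prob_space.real_distribution_distr) (auto simp: prob_space_measure_pmf)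

lemma expectation_rademacher:
  fixes f :: "real \<Rightarrow> real"
  assumes "f \<in> borel_measurable borel"
  shows "prob_space.expectation rademacher f = (f 1 + f (- 1)) / 2"
  unfolding rademacher_def using assms by (subst integral_distr) (auto simp: field_simps)

lemma variance_rademacher: "prob_space.variance rademacher (\<lambda>x. x) = 1"
  by (simp add: expectation_rademacher)

lemma std_dev_rademacher: "std_dev rademacher = 1"
  by (simp add: std_dev_def variance_rademacher)

lemma abs_third_moment_rademacher: "abs_third_moment rademacher = 1"
  by (simp add: abs_third_moment_def expectation_rademacher)

lemma rademacher_in_\<F>\<^sub>1: "rademacher \<in> \<F>\<^sub>1"
proof -
  have "integrable rademacher (\<lambda>x. \<bar>x\<bar> ^ 3)"
    unfolding rademacher_def
    by (subst integrable_distr_eq) (auto intro!: integrable_measure_pmf_finite)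
  then show ?thesis
    by (simp add: \<F>\<^sub>1_def real_distribution_rademacher variance_rademacher)
      (simp add: expectation_rademacher)
qed

lemma normalized_sum_cdf_rademacher_1:
  "normalized_sum_cdf rademacher 1 = (\<lambda>x. if x < - 1 then 0 else if x < 1 then 1 / 2 else 1)"
proof
  fix x
  let ?p = "bernoulli_pmf (1 / 2)" and ?s = "\<lambda>b. if b then 1 else - 1 :: real"
  \<comment> \<open>A family of one variable is trivially independent, so the coin itself can
    replace the one-fold product space.\<close>
  have "prob_space.indep_vars (measure_pmf ?p) (\<lambda>_. borel) (\<lambda>_. ?s) {1..1::nat}"
    by (auto simp: prob_space.indep_vars_def[OF prob_space_measure_pmf]
      prob_space.indep_sets_def[OF prob_space_measure_pmf] subset_singleton_iff)
  then have "normalized_sum_cdf rademacher 1 x =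
      cdf (distr (measure_pmf ?p) borel (\<lambda>b. (\<Sum>i=1..1::nat. ?s b) / (std_dev rademacher * sqrt (real 1)))) x"
    by (subst prob_space.normalized_sum_cdf_eq[OF prob_space_measure_pmf]) (use real_distribution_rademacher in \<open>auto simp: rademacher_def\<close>)
  also have "\<dots> = measure rademacher {..x}"
    by (simp add: cdf_def rademacher_def[symmetric] std_dev_rademacher)
  \<comment> \<open>As the expectation of an indicator, the distribution function is computed by the
    two-point formula.\<close>
  also have "\<dots> = prob_space.expectation rademacher (indicator {..x})"
    using real_distribution_rademacher by (simp add: real_distribution_def real_distribution_axioms_def)
  also have "\<dots> = (if x < - 1 then 0 else if x < 1 then 1 / 2 else 1)"
    by (subst expectation_rademacher) (auto split: split_indicator)
  finally show "normalized_sum_cdf rademacher 1 x = (if x < - 1 then 0 else if x < 1 then 1 / 2 else 1)" .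
qed

section \<open>Numerical bounds\<close>

lemma exp_minus_bounds:
  fixes y :: real
  assumes "y \<ge> 0"
  shows "(\<Sum>m<2 * k. (- y) ^ m / fact m) \<le> exp (- y)"
    and "exp (- y) \<le> (\<Sum>m<2 * k + 1. (- y) ^ m / fact m)"
proof -
  \<comment> \<open>The Lagrange remainder after \<open>n\<close> terms has the sign of
    \<open>(- y) ^ n\<close>: nonnegative for even \<open>n\<close>, nonpositive for odd
    \<open>n\<close> as \<open>y \<ge> 0\<close>.\<close>
  obtain t where "exp (- y) = (\<Sum>m<2 * k. (- y) ^ m / fact m) + exp t / fact (2 * k) * (- y) ^ (2 * k)"
    using Maclaurin_exp_le by blast
  then show "(\<Sum>m<2 * k. (- y) ^ m / fact m) \<le> exp (- y)"
    by simp
  obtain t where "exp (- y) = (\<Sum>m<2 * k + 1. (- y) ^ m / fact m)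
      + exp t / fact (2 * k + 1) * (- y) ^ (2 * k + 1)"
    using Maclaurin_exp_le by blast
  moreover have "exp t / fact (2 * k + 1) * (- y) ^ (2 * k + 1) \<le> 0"
    using assms by (intro mult_nonneg_nonpos) auto
  ultimately show "exp (- y) \<le> (\<Sum>m<2 * k + 1. (- y) ^ m / fact m)"
    by linarith
qed

lemma DERIV_gauss_taylor_antiderivative:
  "((\<lambda>x. \<Sum>m<n. (- 1 / 2) ^ m * x ^ (2 * m + 1) / (fact m * (2 * real m + 1)))
     has_real_derivative (\<Sum>m<n. (- (x\<^sup>2 / 2)) ^ m / fact m)) (at x)"
proof -
  have "(- 1 / 2) ^ m * ((2 * real m + 1) * x ^ (2 * m)) / (fact m * (2 * real m + 1)) =
      (- (x\<^sup>2 / 2)) ^ m / fact m" for m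
  proof -
    have "(- (x\<^sup>2 / 2)) ^ m = (- 1 / 2) ^ m * x ^ (2 * m)"
      by (simp add: power_mult power_mult_distrib[symmetric])
    moreover have "2 * real m + 1 \<noteq> 0" by linarith
    ultimately show ?thesis by (simp only: mult.left_commute[of "(- 1 / 2) ^ m"]) simp
  qed
  note * = this
  have "((\<lambda>x. (- 1 / 2) ^ m * x ^ (2 * m + 1) / (fact m * (2 * real m + 1)))
     has_real_derivative (- 1 / 2) ^ m * ((2 * real m + 1) * x ^ (2 * m)) / (fact m * (2 * real m + 1))) (at x)" for m
    using DERIV_pow[of "2 * m + 1" x] by (intro DERIV_cdivide DERIV_cmult) (simp add: add_ac)
  then show ?thesis
    unfolding * by (intro DERIV_sum)
qed

text \<open>The middle quantity is the integral of exp(-x^2/2) over [0, 1]. Subtracting the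
  integrated Taylor sum from \<open>sqrt (2 * pi) * \<Phi> x\<close> leaves a function whose
  derivative has constant sign by \<open>exp_minus_bounds\<close>; comparing its values at 0 and 1
  gives the bounds.\<close>

lemma \<Phi>_1_bounds:
  "(\<Sum>m<2 * k. (- 1 / 2) ^ m / (fact m * (2 * real m + 1))) \<le> sqrt (2 * pi) * (\<Phi> 1 - 1 / 2)"
  "sqrt (2 * pi) * (\<Phi> 1 - 1 / 2) \<le> (\<Sum>m<2 * k + 1. (- 1 / 2) ^ m / (fact m * (2 * real m + 1)))"
proof -
  let ?P = "\<lambda>n x. \<Sum>m<n. (- 1 / 2) ^ m * x ^ (2 * m + 1) / (fact m * (2 * real m + 1)) :: real"
  let ?D = "\<lambda>n x. \<Sum>m<n. (- (x\<^sup>2 / 2)) ^ m / fact m :: real"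
  have dens: "sqrt (2 * pi) * std_normal_density x = exp (- (x\<^sup>2 / 2))" for x
    by (simp add: std_normal_density_def)
  have D: "((\<lambda>x. sqrt (2 * pi) * \<Phi> x - ?P n x) has_real_derivative exp (- (x\<^sup>2 / 2)) - ?D n x) (at x)" for n x
    unfolding dens[symmetric] by (intro DERIV_diff DERIV_cmult DERIV_\<Phi> DERIV_gauss_taylor_antiderivative)
  have "sqrt (2 * pi) * \<Phi> 0 - ?P (2 * k) 0 \<le> sqrt (2 * pi) * \<Phi> 1 - ?P (2 * k) 1"
  proof (rule DERIV_nonneg_imp_nondecreasing[where f = "\<lambda>x. sqrt (2 * pi) * \<Phi> x - ?P (2 * k) x"])
    show "\<exists>y. ((\<lambda>x. sqrt (2 * pi) * \<Phi> x - ?P (2 * k) x) has_real_derivative y) (at x) \<and> y \<ge> 0" for x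
      using D[of "2 * k" x] exp_minus_bounds(1)[of "x\<^sup>2 / 2" k] by (intro exI conjI) auto
  qed simp
  then show "(\<Sum>m<2 * k. (- 1 / 2) ^ m / (fact m * (2 * real m + 1))) \<le> sqrt (2 * pi) * (\<Phi> 1 - 1 / 2)"
    by (simp add: \<Phi>_0 algebra_simps)
  have "sqrt (2 * pi) * \<Phi> 0 - ?P (2 * k + 1) 0 \<ge> sqrt (2 * pi) * \<Phi> 1 - ?P (2 * k + 1) 1"
  proof (rule DERIV_nonpos_imp_nonincreasing[where f = "\<lambda>x. sqrt (2 * pi) * \<Phi> x - ?P (2 * k + 1) x"])
    show "\<exists>y. ((\<lambda>x. sqrt (2 * pi) * \<Phi> x - ?P (2 * k + 1) x) has_real_derivative y) (at x) \<and> y \<le> 0" for x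
      using D[of "2 * k + 1" x] exp_minus_bounds(2)[of "x\<^sup>2 / 2" k] by (intro exI conjI) auto
  qed simp
  then show "sqrt (2 * pi) * (\<Phi> 1 - 1 / 2) \<le> (\<Sum>m<2 * k + 1. (- 1 / 2) ^ m / (fact m * (2 * real m + 1)))"
    by (simp add: \<Phi>_0 algebra_simps)
qed

lemma sqrt_2_div_pi_bounds: "0.7978845607 \<le> sqrt (2 / pi)" "sqrt (2 / pi) \<le> 0.797884561"
proof -
  \<comment> \<open>After squaring, a lower bound for the root of 2/pi needs an upper bound for pi,
    and conversely.\<close>
  have "0.7978845607\<^sup>2 * pi \<le> 0.7978845607\<^sup>2 * 3.1415926535899"
    using pi_approx by (intro mult_left_mono) auto
  then show "0.7978845607 \<le> sqrt (2 / pi)"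
    by (intro real_le_rsqrt) (simp add: field_simps power2_eq_square)
  have "0.797884561\<^sup>2 * pi \<ge> 0.797884561\<^sup>2 * 3.141592653588"
    using pi_approx by (intro mult_left_mono) auto
  then show "sqrt (2 / pi) \<le> 0.797884561"
    by (intro real_le_lsqrt) (simp_all add: field_simps power2_eq_square)
qed

lemma gauss_integral_bounds:
  defines "S \<equiv> sqrt (2 * pi) * (\<Phi> 1 - 1 / 2)"
  shows "0.85562439 \<le> S" "S \<le> 0.855624393"
  unfolding S_def
  \<comment> \<open>Ten terms bound from below and eleven from above; the gap is the term 1/(2^10 *
    10! * 21), less than 2e-11.\<close>
  using \<Phi>_1_bounds[of 5] by (simp_all add: lessThan_nat_numeral lessThan_Suc fact_numeral power_divide)

lemma exp_minus_half_bounds: "0.606530659 \<le> exp (- 1 / 2 :: real)" "exp (- 1 / 2 :: real) \<le> 0.60653066"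
  using exp_minus_bounds[of "1 / 2" 5] by (simp_all add: lessThan_nat_numeral lessThan_Suc fact_numeral power_divide)

text \<open>Together with the densities at 0 and 1, this reduces every constant below to three
  numbers with known bounds: \<open>sqrt (2 / pi)\<close>, the Gaussian integral over [0, 1] and
  \<open>exp (- 1 / 2)\<close>.\<close>

lemma \<Phi>_1_eq: "\<Phi> 1 = 1 / 2 + sqrt (2 / pi) / 2 * (sqrt (2 * pi) * (\<Phi> 1 - 1 / 2))"
proof -
  have "sqrt (2 / pi) * sqrt (2 * pi) = 2"
    by (simp add: real_sqrt_mult[symmetric])
  then show ?thesis by (simp add: mult.assoc[symmetric])
qed

lemma std_normal_density_0: "std_normal_density 0 = sqrt (2 / pi) / 2"
  and std_normal_density_1: "std_normal_density 1 = sqrt (2 / pi) / 2 * exp (- 1 / 2)"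
proof -
  have "1 / sqrt (2 * pi) = sqrt (2 / pi) / 2"
    by (simp add: real_sqrt_mult real_sqrt_divide field_simps)
  then show "std_normal_density 0 = sqrt (2 / pi) / 2"
    and "std_normal_density 1 = sqrt (2 / pi) / 2 * exp (- 1 / 2)"
    unfolding std_normal_density_def by (simp, metis (no_types) mult.commute power_one)
qed

section \<open>The distance of the fair sign from the normal law\<close>

lemma L1_dist_rademacher_1:
  "L1_dist (normalized_sum_cdf rademacher 1) \<Phi> =
     ennreal (4 * \<Phi> 1 - 3 + 4 * std_normal_density 1 - 2 * std_normal_density 0)"
proof -
  define h where "h x = ennreal \<bar>(if x < - 1 then 0 else if x < 1 then 1 / 2 else 1) - \<Phi> x\<bar>" for x
  let ?g = "\<lambda>x. ennreal (\<Phi> x - 1 / 2) * indicator {0..1} x + ennreal (1 - \<Phi> x) * indicator {1..} x"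
  have [measurable]: "h \<in> borel_measurable borel"
    unfolding h_def by measurable
  \<comment> \<open>At 1 both indicators in \<open>?g\<close> equal one and the two sides differ,
    but a point is a null set.\<close>
  have right: "h x * indicator {0..} x = ?g x" if "x \<noteq> 1" for x
    using \<Phi>_mono[of 0 x] \<Phi>_le_1[of x] that
    by (cases "x < 0"; cases "x < 1") (simp_all add: h_def \<Phi>_0)
  \<comment> \<open>Reflection turns both \<Phi> and, away from its jumps, the step function into
    one minus themselves, so the negative half-line contributes the same integral.\<close>
  have left: "h (- x) * indicator {..<0} (- x) = ?g x" if "x \<noteq> 1" "x \<noteq> 0" for x
    using \<Phi>_mono[of 0 x] \<Phi>_le_1[of x] that
    by (cases "x < 0"; cases "x < 1")
      (simp_all add: h_def \<Phi>_0 \<Phi>_uminus)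
  have 1: "(\<integral>\<^sup>+x. h x * indicator {0..} x \<partial>lborel) = (\<integral>\<^sup>+x. ?g x \<partial>lborel)"
  proof (rule nn_integral_cong_AE)
    show "AE x in lborel. h x * indicator {0..} x = ?g x"
      using AE_lborel_singleton[of 1] by eventually_elim (rule right)
  qed
  have "(\<integral>\<^sup>+x. h x * indicator {..<0} x \<partial>lborel) = (\<integral>\<^sup>+x. h (- x) * indicator {..<0} (- x) \<partial>lborel)"
    using nn_integral_real_affine[of "\<lambda>x. h x * indicator {..<0} x" "- 1" 0] by simp
  also have "\<dots> = (\<integral>\<^sup>+x. ?g x \<partial>lborel)"
  proof (rule nn_integral_cong_AE)
    show "AE x in lborel. h (- x) * indicator {..<0} (- x) = ?g x"
      using AE_lborel_singleton[of 1] AE_lborel_singleton[of 0] by eventually_elim (rule left)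
  qed
  finally have 2: "(\<integral>\<^sup>+x. h x * indicator {..<0} x \<partial>lborel) = (\<integral>\<^sup>+x. ?g x \<partial>lborel)" .
  \<comment> \<open>\<open>ennreal\<close> sends negative reals to 0, so the two values must be
    known nonnegative before they are added as reals.\<close>
  have nonneg: "0 \<le> \<Phi> 1 + std_normal_density 1 - std_normal_density 0 - 1 / 2"
    "0 \<le> \<Phi> 1 + std_normal_density 1 - 1"
  proof -
    let ?r = "sqrt (2 / pi)" and ?S = "sqrt (2 * pi) * (\<Phi> 1 - 1 / 2)" and ?e = "exp (- 1 / 2) :: real"
    have "0 \<le> ?r * (?S + ?e - 1)"
      using gauss_integral_bounds exp_minus_half_bounds by (intro mult_nonneg_nonneg) auto
    then show "0 \<le> \<Phi> 1 + std_normal_density 1 - std_normal_density 0 - 1 / 2"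
      by (subst \<Phi>_1_eq) (simp add: std_normal_density_0 std_normal_density_1 algebra_simps)
    \<comment> \<open>The claim is equivalent to \<open>?r * (?S + ?e) \<ge> 1\<close>, and 0.79 *
      1.4 = 1.106.\<close>
    have "0.79 * 1.4 \<le> ?r * (?S + ?e)"
      using gauss_integral_bounds exp_minus_half_bounds sqrt_2_div_pi_bounds by (intro mult_mono) auto
    then show "0 \<le> \<Phi> 1 + std_normal_density 1 - 1"
      by (subst \<Phi>_1_eq) (simp add: std_normal_density_1 algebra_simps)
  qed
  have "L1_dist (normalized_sum_cdf rademacher 1) \<Phi> = (\<integral>\<^sup>+x. h x \<partial>lborel)"
    unfolding L1_dist_def h_def normalized_sum_cdf_rademacher_1 ..
  also have "\<dots> = (\<integral>\<^sup>+x. h x * indicator {0..} x + h x * indicator {..<0} x \<partial>lborel)"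
    by (intro nn_integral_cong) (auto split: split_indicator)
  also have "\<dots> = (\<integral>\<^sup>+x. ?g x \<partial>lborel) + (\<integral>\<^sup>+x. ?g x \<partial>lborel)"
    by (subst nn_integral_add) (auto simp: 1 2)
  also have "(\<integral>\<^sup>+x. ?g x \<partial>lborel) = ennreal (\<Phi> 1 + std_normal_density 1 - std_normal_density 0 - 1 / 2)
      + ennreal (\<Phi> 1 + std_normal_density 1 - 1)"
    by (subst nn_integral_add) (auto simp: nn_integral_\<Phi>_minus_half_0_1 nn_integral_\<Phi>_upper_tail_1)
  finally show ?thesis
    using nonneg by (simp add: ennreal_plus[symmetric] del: ennreal_plus)
qed

theorem mainTheorem2:
  shows "let b = (2 * sqrt pi * (2 * \<Phi> 1 - 1) - (sqrt pi + sqrt 2) + 2 * exp (- 1 / 2) * sqrt 2)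
                   / sqrt pi
         in c\<^sub>1 \<ge> ereal b \<and> 0.535377 \<le> b \<and> b < 0.535378"
proof -
  define b where "b = (2 * sqrt pi * (2 * \<Phi> 1 - 1) - (sqrt pi + sqrt 2) + 2 * exp (- 1 / 2) * sqrt 2)
                   / sqrt pi"
  let ?r = "sqrt (2 / pi)" and ?S = "sqrt (2 * pi) * (\<Phi> 1 - 1 / 2)" and ?e = "exp (- 1 / 2) :: real"
  have b: "b = 4 * \<Phi> 1 - 3 + 2 * ?r * ?e - ?r"
    by (simp add: b_def real_sqrt_divide add_divide_distrib diff_divide_distrib)
  \<comment> \<open>In this form \<open>b\<close> increases in \<open>?S\<close> and
    \<open>?e\<close>, and also in \<open>?r\<close> because the bracket is positive, so the bounds
    can be inserted factor by factor.\<close>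
  have b': "b = ?r * (2 * ?S + 2 * ?e - 1) - 1"
    unfolding b by (subst \<Phi>_1_eq) (simp add: algebra_simps)
  have "0.7978845607 * 1.92431009 \<le> ?r * (2 * ?S + 2 * ?e - 1)"
    using gauss_integral_bounds exp_minus_half_bounds sqrt_2_div_pi_bounds by (intro mult_mono) auto
  moreover have "?r * (2 * ?S + 2 * ?e - 1) \<le> 0.797884561 * 1.92431011"
    using gauss_integral_bounds exp_minus_half_bounds sqrt_2_div_pi_bounds by (intro mult_mono) auto
  ultimately have num: "0.535377 \<le> b" "b < 0.535378"
    unfolding b' by simp_all
  have "L1_dist (normalized_sum_cdf rademacher 1) \<Phi> = ennreal b"
    by (simp add: L1_dist_rademacher_1[unfolded One_nat_def] std_normal_density_0 std_normal_density_1 b algebra_simps)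
  \<comment> \<open>Positivity of \<open>b\<close>, known from \<open>num\<close>, makes the passage
    through \<open>ennreal\<close> exact.\<close>
  then have val: "ereal (sqrt (real 1) * std_dev rademacher ^ 3)
      * enn2ereal (L1_dist (normalized_sum_cdf rademacher 1) \<Phi>) / ereal (abs_third_moment rademacher) = ereal b"
    using num by (simp add: std_dev_rademacher abs_third_moment_rademacher)
  have "ereal b \<le> c\<^sub>1"
    unfolding c\<^sub>1_def
  \<comment> \<open>Every admissible \<open>C\<close> dominates the quotient of the fair sign at
    \<open>n = 1\<close>, which is \<open>b\<close>. An empty set of admissible constants is covered
    too, its infimum being infinite.\<close>
  proof (rule Inf_greatest, clarify)
    fix C :: real
    assume "\<forall>G\<in>\<F>\<^sub>1. \<forall>n\<ge>1. ereal (sqrt (real n) * std_dev G ^ 3)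
      * enn2ereal (L1_dist (normalized_sum_cdf G n) \<Phi>) / ereal (abs_third_moment G) \<le> ereal C"
    then show "ereal b \<le> ereal C"
      using rademacher_in_\<F>\<^sub>1 val by (metis order_refl)
  qed
  then show ?thesis
    using num unfolding b_def Let_def by blast
qed

end
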